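(* Let $H=(V,E)$ be a connected graph with maximum degree $\Delta(H)\geq 5$, and suppose that $H$ is $(K_{\Delta(H)+1}\setminus e)$-free. Let $p$ and $q$ be two positive integers such that $p\geq 2$, $q\geq 4$ and $\Delta(H)+1=p+q$. Let $\mathcal{G}$ be a collection of graphs, each with minimum degree at least $p-1$. Then there exists a partition $(V_1,V_2)$ of $V(H)$ such that $H[V_1]$ is a maximum order $\mathcal{G}$-free induced subgraph of $H$, $\Delta(H[V_2])\leq q$, and either $H[V_2]$ is $K_q$-free or its $q$-cliques are disjoint.
   Context: All graphs are finite, undirected and simple. $\Delta(\cdot)$ denotes the maximum degree, $H[W]$ the subgraph of $H$ induced on $W\subseteq V(H)$, and $K_n$ the complete graph on $n$ vertices; $K_n\setminus e$ is the graph obtained from $K_n$ by removing one edge. For a graph $G$, a graph is $G$-free if it contains no subgraph (not necessarily induced) isomorphic to $G$; for a family $\mathcal{G}$ of graphs, a graph is $\mathcal{G}$-free if it is $G$-free for every $G\in\mathcal{G}$. "$H[V_1]$ is a maximum order $\mathcal{G}$-free induced subgraph of $H$" means that $H[V_1]$ is $\mathcal{G}$-free and $|V_1|\geq |S|$ for every $S\subseteq V(H)$ with $H[S]$ $\mathcal{G}$-free. A $q$-clique of a graph is a complete subgraph on $q$ vertices; "its $q$-cliques are disjoint" means that any two distinct $q$-cliques have no common vertex. *)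

theory Defs
  imports "Graph_Theory.Graph_Theory"
begin

text \<open>
  Finite simple undirected graphs are the locale \<^locale>\<open>graph\<close>: finite symmetric digraphs without
  loops or parallel arcs. An undirected edge is a pair of opposite arcs, so the degree of a
  vertex, i.e. its number of neighbours, is its \<^const>\<open>out_degree\<close>.
\<close>

text \<open>Inserting 0 only matters for the null graph (an empty part of a partition), where the
  maximum degree is 0.\<close>

definition max_degree :: "('a,'b) pre_digraph \<Rightarrow> nat" where
  "max_degree G = Max (insert 0 (out_degree G ` verts G))"

text \<open>Only meaningful if the vertex set is nonempty.\<close>

definition min_degree :: "('a,'b) pre_digraph \<Rightarrow> nat" where
  "min_degree G = Min (out_degree G ` verts G)"

definition graph_free :: "('c,'d) pre_digraph \<Rightarrow> ('a,'b) pre_digraph \<Rightarrow> bool" where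
  "graph_free G H \<longleftrightarrow> \<not> (\<exists>S. subgraph S H \<and> digraph_iso G S)"

definition family_free :: "('c,'d) pre_digraph set \<Rightarrow> ('a,'b) pre_digraph \<Rightarrow> bool" where
  "family_free \<G> H \<longleftrightarrow> (\<forall>G\<in>\<G>. graph_free G H)"

definition max_order_free_induced ::
    "('c,'d) pre_digraph set \<Rightarrow> ('a,'b) pre_digraph \<Rightarrow> 'a set \<Rightarrow> bool" where
  "max_order_free_induced \<G> H W \<longleftrightarrow>
     W \<subseteq> verts H \<and> family_free \<G> (H \<restriction> W) \<and>
     (\<forall>S. S \<subseteq> verts H \<and> family_free \<G> (H \<restriction> S) \<longrightarrow> card S \<le> card W)"

definition complete_graph :: "nat \<Rightarrow> (nat, nat \<times> nat) pre_digraph" where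
  "complete_graph n =
     with_proj \<lparr> pverts = {..<n}, parcs = {(i, j). i < n \<and> j < n \<and> i \<noteq> j} \<rparr>"

text \<open>All edges of a complete graph are equivalent under isomorphism; the removed edge is the one
  joining 0 and 1 (for \<open>n \<ge> 2\<close>).\<close>

definition complete_graph_minus_edge :: "nat \<Rightarrow> (nat, nat \<times> nat) pre_digraph" where
  "complete_graph_minus_edge n =
     with_proj \<lparr> pverts = {..<n},
       parcs = {(i, j). i < n \<and> j < n \<and> i \<noteq> j} - {(0, 1), (1, 0)} \<rparr>"

definition cliques :: "nat \<Rightarrow> ('a,'b) pre_digraph \<Rightarrow> ('a,'b) pre_digraph set" where
  "cliques q G = {S. subgraph S G \<and> complete_digraph q S}"

definition cliques_disjoint :: "nat \<Rightarrow> ('a,'b) pre_digraph \<Rightarrow> bool" where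
  "cliques_disjoint q G \<longleftrightarrow>
     (\<forall>S\<in>cliques q G. \<forall>T\<in>cliques q G. S \<noteq> T \<longrightarrow> verts S \<inter> verts T = {})"

lemma complete_digraph_complete_graph: "complete_digraph n (complete_graph n)"
  by (auto simp: complete_graph_def complete_digraph_pair_def)

lemma graph_complete_graph_minus_edge: "graph (complete_graph_minus_edge n)"
proof -
  let ?G = "\<lparr> pverts = {..<n},
    parcs = {(i, j). i < n \<and> j < n \<and> i \<noteq> j} - {(0, 1), (1, 0)} \<rparr> :: nat pair_pre_digraph"
  have "finite (parcs ?G)"
    by (rule finite_subset[of _ "{..<n} \<times> {..<n}"]) auto
  then have "pair_graph ?G"
    by unfold_locales (auto simp: symmetric_def sym_def)
  then show ?thesis
    unfolding complete_graph_minus_edge_def by (rule pair_graph.pair_graphD_graph)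
qed

end

theory Submission
  imports Defs
begin

text \<open>
  Let \<open>X\<close> be a largest \<open>\<G>\<close>-free vertex set. A vertex \<open>v\<close> outside \<open>X\<close> has at least \<open>p - 1\<close>
  neighbours in \<open>X\<close>, because adding \<open>v\<close> to \<open>X\<close> creates a copy of a member of \<open>\<G>\<close> through \<open>v\<close>.
  Hence the maximum degree outside \<open>X\<close> is at most \<open>q\<close>. Under this bound two distinct intersecting
  \<open>q\<close>-cliques share \<open>q - 1\<close> vertices, so their union is a \<^emph>\<open>bad set\<close>: \<open>q + 1\<close> vertices outside \<open>X\<close>
  with at most one missing edge. It remains to find \<open>X\<close> without bad sets.

  The tool is an exchange. If \<open>f\<close> is outside \<open>X\<close> and has exactly \<open>p - 1\<close> neighbours in \<open>X\<close>, then any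
  such neighbour \<open>u\<close> may be replaced by \<open>f\<close>: a forbidden copy in the new set would pass through \<open>f\<close>,
  whose degree has become too small. A vertex \<open>f\<close> that is adjacent to all other vertices of a bad set
  \<open>C\<close> already has \<open>q\<close> neighbours in \<open>C\<close>, so it can be exchanged. Take \<open>X\<close> with the least number of
  bad sets. The exchange destroys \<open>C\<close>, so it creates a bad set \<open>C'\<close> through \<open>u\<close>. An overlap
  argument (\<open>near_clique_absorbed\<close>, which needs \<open>q \<ge> 4\<close>) shows that the exchange is either local,
  \<open>C' = C - {f} \<union> {u}\<close>, or far, \<open>C' \<inter> C = {}\<close>.

  If all exchanges with \<open>f\<close> were local, then the \<open>p - 1\<close> neighbours of \<open>f\<close> in \<open>X\<close> would be adjacent to
  all of \<open>C\<close> and to each other. Together with \<open>C\<close> they would form \<open>p + q\<close> vertices with at most one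
  missing edge, that is, a copy of the excluded complete graph minus an edge. So far exchanges always
  exist (\<open>far_nbr\<close>), at least after a preparatory local exchange that makes \<open>C\<close> \<^emph>\<open>settled\<close>.

  Now perform far exchanges one after another. Each leaves behind a block \<open>C - {f}\<close> of \<open>q\<close> vertices.
  A later bad set that met the block would contain it, together with one new vertex \<open>u\<close>. This \<open>u\<close>
  would have at least three neighbours in the earlier settled bad set, hence all its outer
  neighbours there, although it was just exchanged along an edge to a vertex elsewhere. So the blocks
  are pairwise disjoint and the process never ends (\<open>walk_step\<close>), which is absurd in a finite graph.
\<close>

section \<open>Sets with at most one missing edge\<close>

locale adjacency =
  fixes adj :: "'a \<Rightarrow> 'a \<Rightarrow> bool"
  assumes adj_sym: "adj x y \<Longrightarrow> adj y x"
    and adj_irrefl: "\<not> adj x x"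
begin

definition nbrs :: "'a \<Rightarrow> 'a set \<Rightarrow> 'a set" where
  "nbrs v W = {w \<in> W. adj v w}"

text \<open>The pair \<open>{x, y}\<close> may be degenerate or lie outside \<open>W\<close>, in which case \<open>W\<close> is a clique.\<close>

definition near_clique :: "'a set \<Rightarrow> bool" where
  "near_clique W \<longleftrightarrow> (\<exists>x y. \<forall>a\<in>W. \<forall>b\<in>W. a \<noteq> b \<longrightarrow> adj a b \<or> {a, b} = {x, y})"

definition full :: "'a \<Rightarrow> 'a set \<Rightarrow> bool" where
  "full v W \<longleftrightarrow> v \<in> W \<and> (\<forall>w\<in>W. w \<noteq> v \<longrightarrow> adj v w)"

lemma finite_nbrs [simp]: "finite W \<Longrightarrow> finite (nbrs v W)"
  by (simp add: nbrs_def)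

lemma nbrs_subset: "nbrs v W \<subseteq> W"
  by (auto simp: nbrs_def)

lemma near_clique_subset: "near_clique W \<Longrightarrow> W' \<subseteq> W \<Longrightarrow> near_clique W'"
  unfolding near_clique_def by (elim exE) (intro exI, blast)

lemma near_clique_unique:
  assumes "near_clique W" "a \<in> W" "b \<in> W" "a \<noteq> b" "\<not> adj a b"
    and "c \<in> W" "d \<in> W" "c \<noteq> d" "\<not> adj c d"
  shows "{a, b} = {c, d}"
proof -
  obtain x y where xy: "\<And>u v. u \<in> W \<Longrightarrow> v \<in> W \<Longrightarrow> u \<noteq> v \<Longrightarrow> adj u v \<or> {u, v} = {x, y}"
    using assms(1) unfolding near_clique_def by blast
  show ?thesis using xy[OF assms(2-4)] xy[OF assms(6-8)] assms(5,9) by simp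
qed

lemma near_clique_if_missing:
  assumes "\<And>a b. a \<in> W \<Longrightarrow> b \<in> W \<Longrightarrow> a \<noteq> b \<Longrightarrow> adj a b \<or> {a, b} = {x, y}"
  shows "near_clique W"
  using assms unfolding near_clique_def by blast

lemma not_fullE:
  assumes "\<not> full v W" "v \<in> W"
  obtains w where "w \<in> W" "w \<noteq> v" "\<not> adj v w"
  using assms by (auto simp: full_def)

text \<open>Only the two ends of the missing edge can fail to be full.\<close>

lemma card_not_full:
  assumes "near_clique W"
  shows "card {v \<in> W. \<not> full v W} \<le> 2"
proof -
  obtain x y where xy: "\<forall>a\<in>W. \<forall>b\<in>W. a \<noteq> b \<longrightarrow> adj a b \<or> {a, b} = {x, y}"
    using assms unfolding near_clique_def by blast
  have "{v \<in> W. \<not> full v W} \<subseteq> {x, y}"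
  proof
    fix v assume "v \<in> {v \<in> W. \<not> full v W}"
    then obtain w where "v \<in> W" "w \<in> W" "w \<noteq> v" "\<not> adj v w" by (auto simp: full_def)
    then have "{v, w} = {x, y}" using xy by metis
    then show "v \<in> {x, y}" by blast
  qed
  then have "card {v \<in> W. \<not> full v W} \<le> card {x, y}"
    by (intro card_mono) auto
  also have "\<dots> \<le> 2" by (simp add: card_insert_if)
  finally show ?thesis .
qed

lemma obtain_full:
  assumes "near_clique W" "finite N" "card N + 2 < card W"
  obtains f where "full f W" "f \<notin> N"
proof -
  have fin: "finite W" using assms(3) card.infinite by fastforce
  have "card ({v \<in> W. \<not> full v W} \<union> N) \<le> 2 + card N"
    using card_not_full[OF assms(1)] card_Un_le by (meson add_le_mono1 le_trans)
  then have "\<not> W \<subseteq> {v \<in> W. \<not> full v W} \<union> N"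
    using assms fin card_mono[of "{v \<in> W. \<not> full v W} \<union> N" W] by auto
  then show thesis using that by (auto simp: full_def)
qed

text \<open>The two vertices that may be lost are \<open>v\<close> itself and the other end of the missing edge.\<close>

lemma near_clique_degree:
  assumes "near_clique W" "v \<in> W" "finite W"
  shows "card W \<le> card (nbrs v W) + 2"
proof -
  have "\<exists>z. W \<subseteq> nbrs v W \<union> {v, z}"
  proof (cases "full v W")
    case True
    then show ?thesis by (auto simp: full_def nbrs_def)
  next
    case False
    then obtain z where z: "z \<in> W" "z \<noteq> v" "\<not> adj v z" using assms(2) by (rule not_fullE)
    have "W \<subseteq> nbrs v W \<union> {v, z}"
    proof
      fix w assume "w \<in> W"
      then show "w \<in> nbrs v W \<union> {v, z}"
        using near_clique_unique[OF assms(1,2) z(1) z(2)[symmetric] z(3) assms(2), of w]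
        by (auto simp: nbrs_def doubleton_eq_iff)
    qed
    then show ?thesis by blast
  qed
  then obtain z where "W \<subseteq> nbrs v W \<union> {v, z}" by blast
  then have "card W \<le> card (nbrs v W \<union> {v, z})"
    using assms(3) by (intro card_mono) auto
  also have "\<dots> \<le> card (nbrs v W) + card {v, z}" by (rule card_Un_le)
  also have "card {v, z} \<le> 2" by (simp add: card_insert_if)
  finally show ?thesis by simp
qed

text \<open>
  Some common vertex \<open>g\<close> has no missing edge in \<open>C\<close>: otherwise the only common vertices would be the
  two nonadjacent vertices of \<open>C\<close>, the neighbours of such a vertex in \<open>B\<close> and in \<open>C\<close> would be disjoint,
  and there would be \<open>2 q - 3 > q\<close> of them. By the degree bound the neighbourhood of \<open>g\<close> in \<open>U\<close> is
  \<open>C - {g}\<close>, so every vertex of \<open>B\<close> outside \<open>C\<close> costs \<open>B\<close> an edge, and \<open>B\<close> can afford only one.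
\<close>

lemma near_clique_absorbed:
  assumes C: "near_clique C" "card C = Suc q" "C \<subseteq> U"
    and B: "near_clique B" "card B = q" "B \<subseteq> U"
    and U: "finite U" "\<And>v. v \<in> U \<Longrightarrow> card (nbrs v U) \<le> q"
    and q: "q \<ge> 4" and meet: "B \<inter> C \<noteq> {}"
  shows "B \<subseteq> C"
proof (rule ccontr)
  assume "\<not> B \<subseteq> C"
  then obtain b where b: "b \<in> B" "b \<notin> C" by blast
  have finC: "finite C" and finB: "finite B" using U C B finite_subset by auto
  have "\<exists>g\<in>B \<inter> C. full g C"
  proof (rule ccontr)
    assume none: "\<not> (\<exists>g\<in>B \<inter> C. full g C)"
    obtain x where x: "x \<in> B" "x \<in> C" using meet by blast
    then have "\<not> full x C" using none by blast
    then obtain y where y: "y \<in> C" "y \<noteq> x" "\<not> adj x y" using x by (metis not_fullE)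
    have disj: "nbrs x C \<inter> nbrs x B = {}"
    proof (rule ccontr)
      assume "nbrs x C \<inter> nbrs x B \<noteq> {}"
      then obtain w where w: "w \<in> C" "w \<in> B" "adj x w" by (auto simp: nbrs_def)
      then have "\<not> full w C" using none by blast
      then obtain w' where w': "w' \<in> C" "w' \<noteq> w" "\<not> adj w w'" using w by (metis not_fullE)
      have "{x, y} = {w, w'}"
        using near_clique_unique[OF C(1) x(2) y(1) y(2)[symmetric] y(3) w(1) w'(1)] w' by blast
      then have "w = x \<or> w = y" by auto
      then show False using w y adj_irrefl by blast
    qed
    have "card (nbrs x C) + card (nbrs x B) = card (nbrs x C \<union> nbrs x B)"
      using disj finC finB by (simp add: card_Un_disjoint)
    also have "\<dots> \<le> card (nbrs x U)"
      using C B U by (intro card_mono) (auto simp: nbrs_def)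
    also have "\<dots> \<le> q" using U x C by blast
    finally show False
      using near_clique_degree[OF C(1) x(2) finC] near_clique_degree[OF B(1) x(1) finB] C B q
      by linarith
  qed
  then obtain g where g: "g \<in> B" "g \<in> C" "full g C" by blast
  have full_nbrs: "nbrs h U = C - {h}" if h: "full h C" for h
  proof -
    have "C - {h} \<subseteq> nbrs h U" using h C by (auto simp: full_def nbrs_def)
    moreover have "card (C - {h}) = q" using h C by (simp add: full_def)
    moreover have "card (nbrs h U) \<le> q" using h U C by (auto simp: full_def)
    ultimately show ?thesis using U(1) by (metis card_seteq finite_nbrs)
  qed
  have nonadj: "\<not> adj h b" if "full h C" for h
    using full_nbrs[OF that] b B by (auto simp: nbrs_def)
  have gb: "g \<noteq> b" using g b by blast
  have only: "{c, d} = {g, b}" if "c \<in> B" "d \<in> B" "c \<noteq> d" "\<not> adj c d" for c d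
    using near_clique_unique[OF B(1) that g(1) b(1) gb nonadj[OF g(3)]] .
  \<comment> \<open>Suppose \<open>B\<close> leaves \<open>C\<close> at \<open>b\<close>. Its missing edge is \<open>g b\<close>, so the rest of \<open>B\<close> is adjacent to \<open>g\<close> and
    hence lies in \<open>C\<close>, and it is adjacent to \<open>b\<close>, so none of it is full in \<open>C\<close>. Two such vertices would
    have to be nonadjacent, which \<open>B\<close> does not allow.\<close>
  have "card (B - {g, b}) \<ge> 2"
    using B q finB by (simp add: card_Diff_subset g b gb)
  then obtain S where "S \<subseteq> B - {g, b}" "card S = 2"
    by (meson obtain_subset_with_card_n)
  then obtain h h' where h: "h \<in> B - {g, b}" "h' \<in> B - {g, b}" "h \<noteq> h'"
    by (auto simp: card_2_iff)
  have inC: "k \<in> C" if "k \<in> B - {g, b}" for k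
  proof -
    have "adj g k" using only[of g k] g that by (auto simp: doubleton_eq_iff)
    then show ?thesis using full_nbrs[OF g(3)] that B by (auto simp: nbrs_def)
  qed
  have nfull: "\<not> full k C" if "k \<in> B - {g, b}" for k
    using nonadj[of k] only[of k b] that b by (auto simp: doubleton_eq_iff)
  obtain w where w: "w \<in> C" "w \<noteq> h" "\<not> adj h w" using nfull[OF h(1)] inC[OF h(1)] by (metis not_fullE)
  obtain w' where w': "w' \<in> C" "w' \<noteq> h'" "\<not> adj h' w'" using nfull[OF h(2)] inC[OF h(2)] by (metis not_fullE)
  have "{h, w} = {h', w'}"
    using near_clique_unique[OF C(1) inC[OF h(1)] w(1) w(2)[symmetric] w(3) inC[OF h(2)] w'(1)] w' by blast
  then have "w = h'" using h by (auto simp: doubleton_eq_iff)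
  then have "{h, h'} = {g, b}" using only[of h h'] w h by auto
  then show False using h by (auto simp: doubleton_eq_iff)
qed

end

section \<open>Exchange families and bad sets\<close>

text \<open>
  The properties of the family of largest \<open>\<G>\<close>-free vertex sets that the argument uses. The number
  \<open>p + q - 1\<close> is the maximum degree, so the excluded near-cliques have one vertex more than that.
\<close>

locale exchange_family = adjacency adj for adj :: "'a \<Rightarrow> 'a \<Rightarrow> bool" +
  fixes V :: "'a set" and p q :: nat and \<X> :: "'a set set"
  assumes finite_V: "finite V"
    and q_ge_4: "q \<ge> 4"
    and degree_less: "v \<in> V \<Longrightarrow> card (nbrs v V) < p + q"
    and no_large_near_clique: "W \<subseteq> V \<Longrightarrow> card W = p + q \<Longrightarrow> \<not> near_clique W"
    and subset_V: "X \<in> \<X> \<Longrightarrow> X \<subseteq> V"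
    and saturated: "X \<in> \<X> \<Longrightarrow> v \<in> V - X \<Longrightarrow> p \<le> card (nbrs v X) + 1"
    and exchange: "X \<in> \<X> \<Longrightarrow> v \<in> V - X \<Longrightarrow> card (nbrs v X) + 1 = p \<Longrightarrow> u \<in> nbrs v X \<Longrightarrow>
          insert v (X - {u}) \<in> \<X>"
    and family_nonempty: "\<X> \<noteq> {}"
begin

definition bad :: "'a set \<Rightarrow> 'a set set" where
  "bad X = {C. C \<subseteq> V - X \<and> card C = Suc q \<and> near_clique C}"

text \<open>
  Minimality of the number of bad sets is what makes every destroyed bad set reappear elsewhere.
\<close>

definition tight :: "'a set \<Rightarrow> bool" where
  "tight X \<longleftrightarrow> X \<in> \<X> \<and> (\<forall>Y\<in>\<X>. card (bad X) \<le> card (bad Y))"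

definition swap :: "'a set \<Rightarrow> 'a \<Rightarrow> 'a \<Rightarrow> 'a set" where
  "swap X u f = insert f (X - {u})"

lemma finite_bad [simp]: "finite (bad X)"
  by (rule finite_subset[of _ "Pow V"]) (auto simp: bad_def finite_V)

lemma bad_finite: "C \<in> bad X \<Longrightarrow> finite C"
  unfolding bad_def using card.infinite by fastforce

lemma finite_subset_V: "W \<subseteq> V \<Longrightarrow> finite W"
  using finite_V finite_subset by blast

lemma badD:
  assumes "C \<in> bad X"
  shows "C \<subseteq> V" "C \<inter> X = {}" "card C = Suc q" "near_clique C" "finite C"
  using assms bad_finite[OF assms] by (auto simp: bad_def)

lemma card_nbrs_split:
  assumes "X \<subseteq> V"
  shows "card (nbrs v V) = card (nbrs v X) + card (nbrs v (V - X))"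
proof -
  have "nbrs v V = nbrs v X \<union> nbrs v (V - X)" using assms by (auto simp: nbrs_def)
  moreover have "nbrs v X \<inter> nbrs v (V - X) = {}" by (auto simp: nbrs_def)
  moreover have "finite (nbrs v X)" "finite (nbrs v (V - X))"
    using finite_subset_V[OF assms] finite_V by auto
  ultimately show ?thesis by (simp add: card_Un_disjoint)
qed

lemma outer_degree_le:
  assumes "X \<in> \<X>" "v \<in> V - X"
  shows "card (nbrs v (V - X)) \<le> q"
proof -
  have "v \<in> V" using assms(2) by blast
  then show ?thesis
    using card_nbrs_split[OF subset_V[OF assms(1)], of v] saturated[OF assms] degree_less[of v]
    by linarith
qed

text \<open>
  A full vertex uses up all \<open>q\<close> outer neighbours within its bad set, which leaves exactly \<open>p - 1\<close>
  neighbours in \<open>X\<close>. This is what makes it exchangeable.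
\<close>

lemma full_nbrs:
  assumes "X \<in> \<X>" "C \<in> bad X" "full f C"
  shows "nbrs f (V - X) = C - {f}" "card (nbrs f X) + 1 = p"
proof -
  note C = badD[OF assms(2)]
  have f: "f \<in> V - X" using C assms(3) by (auto simp: full_def)
  have "C - {f} \<subseteq> nbrs f (V - X)" using C assms(3) by (auto simp: full_def nbrs_def)
  moreover have card: "card (C - {f}) = q" using C assms(3) by (simp add: full_def)
  moreover have "card (nbrs f (V - X)) \<le> q" using outer_degree_le[OF assms(1) f] .
  ultimately show *: "nbrs f (V - X) = C - {f}"
    using finite_V by (intro card_seteq[symmetric]) auto
  have "f \<in> V" using f by blast
  then have "card (nbrs f X) + q < p + q"
    using degree_less[of f] card_nbrs_split[OF subset_V[OF assms(1)], of f] * card by simp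
  then show "card (nbrs f X) + 1 = p"
    using saturated[OF assms(1) f] by simp
qed

lemma bad_absorbs:
  assumes "X \<in> \<X>" "C \<in> bad X" "near_clique B" "card B = q" "B \<subseteq> V - X" "B \<inter> C \<noteq> {}"
  shows "B \<subseteq> C"
  using near_clique_absorbed[of C q "V - X" B] assms badD[OF assms(2)] outer_degree_le[OF assms(1)]
    finite_V q_ge_4 by auto

text \<open>
  By \<open>bad_absorbs\<close>, \<open>C\<close> absorbs \<open>D - {d}\<close> for every \<open>d\<close> whose removal keeps a common vertex, and two
  such \<open>d\<close> suffice to recover \<open>D\<close>.
\<close>

lemma bad_disjoint:
  assumes "X \<in> \<X>" "C \<in> bad X" "D \<in> bad X" "C \<inter> D \<noteq> {}"
  shows "C = D"
proof -
  note C = badD[OF assms(2)] and D = badD[OF assms(3)]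
  have sub: "D - {d} \<subseteq> C" if "d \<in> D" "C \<inter> (D - {d}) \<noteq> {}" for d
    using bad_absorbs[OF assms(1,2), of "D - {d}"] that D near_clique_subset[OF D(4), of "D - {d}"]
    by auto
  obtain c where c: "c \<in> C" "c \<in> D" using assms(4) by blast
  have "card (D - {c}) \<ge> 2" using D c q_ge_4 by simp
  then obtain S where "S \<subseteq> D - {c}" "card S = 2" by (meson obtain_subset_with_card_n)
  then obtain d e where "d \<in> D" "e \<in> D" "d \<noteq> e" "d \<noteq> c" "e \<noteq> c" by (auto simp: card_2_iff)
  then have "D \<subseteq> C" using sub[of d] sub[of e] c by blast
  then show ?thesis using C D card_subset_eq[of C D] by simp
qed

lemma outside_swap:
  assumes "X \<subseteq> V" "u \<in> X" "f \<in> V - X"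
  shows "V - swap X u f = insert u (V - X - {f})"
  using assms by (auto simp: swap_def)

text \<open>
  The exchange destroys \<open>C\<close>, and every bad set that it creates contains \<open>u\<close>. By disjointness only
  one can be created, so the number of bad sets does not grow, and by minimality one must be created.
  That one either absorbs \<open>C - {f}\<close> or avoids \<open>C\<close>.
\<close>

lemma tight_swap:
  assumes tight: "tight X" and C: "C \<in> bad X" and f: "full f C" and u: "u \<in> X" "adj f u"
  obtains C' where "tight (swap X u f)" "C' \<in> bad (swap X u f)" "u \<in> C'"
    "C' = insert u (C - {f}) \<or> C' \<inter> C = {}"
proof -
  let ?X = "swap X u f"
  have X: "X \<in> \<X>" using tight by (simp add: tight_def)
  have fC: "f \<in> C" using f by (simp add: full_def)
  have fV: "f \<in> V - X" using fC badD[OF C] by blast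
  have X': "?X \<in> \<X>"
    unfolding swap_def using exchange[OF X fV full_nbrs(2)[OF X C f]] u by (simp add: nbrs_def)
  have out: "V - ?X = insert u (V - X - {f})" using outside_swap[OF subset_V[OF X] u(1) fV] .
  have old: "D \<in> bad X - {C}" if "D \<in> bad ?X" "u \<notin> D" for D
    using that out fC unfolding bad_def by auto
  have le: "card (bad X) \<le> card (bad ?X)" using tight X' by (simp add: tight_def)
  have less: "card (bad X - {C}) < card (bad X)" using C by (intro card_Diff1_less) auto
  have "\<exists>C'\<in>bad ?X. u \<in> C'"
  proof (rule ccontr)
    assume "\<not> ?thesis"
    then have "bad ?X \<subseteq> bad X - {C}" using old by blast
    then have "card (bad ?X) \<le> card (bad X - {C})" by (intro card_mono) auto
    then show False using le less by linarith
  qed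
  then obtain C' where C': "C' \<in> bad ?X" "u \<in> C'" by blast
  have "bad ?X \<subseteq> insert C' (bad X - {C})"
    using old bad_disjoint[OF X' C'(1)] C'(2) by blast
  then have "card (bad ?X) \<le> card (insert C' (bad X - {C}))" by (intro card_mono) auto
  also have "\<dots> \<le> Suc (card (bad X - {C}))" by (simp add: card_insert_if)
  also have "\<dots> \<le> card (bad X)" using less by simp
  finally have "tight ?X" using tight X' unfolding tight_def by (meson le_trans)
  moreover have "C' = insert u (C - {f}) \<or> C' \<inter> C = {}"
  proof (rule disjCI)
    assume "C' \<inter> C \<noteq> {}"
    moreover have "f \<notin> C'" using badD[OF C'(1)] by (auto simp: swap_def)
    ultimately have meet: "(C - {f}) \<inter> C' \<noteq> {}" by blast
    have "C - {f} \<subseteq> V - ?X" using out badD[OF C] by auto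
    then have sub: "C - {f} \<subseteq> C'"
      using bad_absorbs[OF X' C'(1) _ _ _ meet] near_clique_subset[OF badD(4)[OF C]] badD[OF C] fC
      by auto
    have "u \<notin> C" using badD[OF C] u by blast
    then have "card (insert u (C - {f})) = card C'" using badD[OF C] badD[OF C'(1)] fC by simp
    then show "C' = insert u (C - {f})"
      using sub C'(2) card_subset_eq[OF badD(5)[OF C'(1)], of "insert u (C - {f})"] by simp
  qed
  ultimately show thesis using that C' by blast
qed

text \<open>
  A far exchange would give \<open>u\<close> at least \<open>q - 1\<close> neighbours in the new bad set, in addition to the two
  that remain in \<open>C - {f}\<close>. This exceeds the outer degree bound.
\<close>

lemma local_swap:
  assumes tight: "tight X" and C: "C \<in> bad X" and u: "u \<in> X" "card (nbrs u C) \<ge> 3"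
    and f: "full f C" "adj f u"
  shows "tight (swap X u f)" "insert u (C - {f}) \<in> bad (swap X u f)"
proof -
  obtain C' where C': "tight (swap X u f)" "C' \<in> bad (swap X u f)" "u \<in> C'"
    "C' = insert u (C - {f}) \<or> C' \<inter> C = {}"
    using tight_swap[OF tight C f(1) u(1) f(2)] by blast
  have X': "swap X u f \<in> \<X>" using C'(1) by (simp add: tight_def)
  have "C' \<inter> C \<noteq> {}"
  proof
    assume disj: "C' \<inter> C = {}"
    have fC: "f \<in> C" "f \<in> V - X" using f badD[OF C] by (auto simp: full_def)
    have X: "X \<subseteq> V" using tight subset_V by (simp add: tight_def)
    have uV: "u \<in> V - swap X u f" using u(1) X fC by (auto simp: swap_def)
    have "nbrs u C' \<union> nbrs u (C - {f}) \<subseteq> nbrs u (V - swap X u f)"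
      using badD[OF C'(2)] badD[OF C] outside_swap[OF X u(1) fC(2)] by (auto simp: nbrs_def)
    then have "card (nbrs u C' \<union> nbrs u (C - {f})) \<le> q"
      using outer_degree_le[OF X' uV] finite_V
        card_mono[of "nbrs u (V - swap X u f)" "nbrs u C' \<union> nbrs u (C - {f})"] by simp
    moreover have "nbrs u C' \<inter> nbrs u (C - {f}) = {}" using disj by (auto simp: nbrs_def)
    moreover have "nbrs u (C - {f}) = nbrs u C - {f}" by (auto simp: nbrs_def)
    moreover have "card (nbrs u C) \<le> card (nbrs u C - {f}) + 1"
      using badD[OF C] by (simp add: card_Diff_singleton_if) arith
    ultimately show False
      using near_clique_degree[OF badD(4)[OF C'(2)] C'(3) badD(5)[OF C'(2)]] badD[OF C'(2)] badD[OF C] u(2)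
      by (simp add: card_Un_disjoint)
  qed
  then show "tight (swap X u f)" "insert u (C - {f}) \<in> bad (swap X u f)" using C' by auto
qed

section \<open>Existence of far neighbours\<close>

definition complete_to :: "'a \<Rightarrow> 'a set \<Rightarrow> bool" where
  "complete_to u C \<longleftrightarrow> (\<forall>c\<in>C. adj u c)"

text \<open>
  A vertex of \<open>X\<close> with at least three neighbours in \<open>C\<close> can only be exchanged locally, which makes it
  adjacent to all but at most one vertex of \<open>C\<close>. In a settled pair this exception does not occur.
\<close>

definition settled :: "'a set \<Rightarrow> 'a set \<Rightarrow> bool" where
  "settled X C \<longleftrightarrow> tight X \<and> C \<in> bad X \<and> (\<forall>u\<in>X. card (nbrs u C) \<ge> 3 \<longrightarrow> complete_to u C)"

definition missing :: "'a set \<Rightarrow> bool" where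
  "missing C \<longleftrightarrow> (\<exists>x\<in>C. \<exists>y\<in>C. x \<noteq> y \<and> \<not> adj x y)"

lemma full_if_not_missing: "\<not> missing C \<Longrightarrow> f \<in> C \<Longrightarrow> full f C"
  by (auto simp: missing_def full_def)

lemma missing_Diff_full:
  assumes "missing C" "full f C"
  shows "missing (C - {f})"
proof -
  obtain x y where xy: "x \<in> C" "y \<in> C" "x \<noteq> y" "\<not> adj x y"
    using assms(1) by (auto simp: missing_def)
  have "\<not> adj y x" using xy(4) adj_sym[of y x] by blast
  then have "x \<noteq> f" "y \<noteq> f" using xy assms(2) by (auto simp: full_def)
  then show ?thesis using xy by (auto simp: missing_def)
qed

lemma obtain_full_nbr:
  assumes C: "C \<in> bad X" and u: "card (nbrs u C) \<ge> 3"
  obtains f where "full f C" "adj f u"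
proof -
  have "\<not> nbrs u C \<subseteq> {v \<in> C. \<not> full v C}"
    using card_not_full[OF badD(4)[OF C]] u badD(5)[OF C]
      card_mono[of "{v \<in> C. \<not> full v C}" "nbrs u C"] by auto
  then obtain f where "full f C" "adj u f" by (auto simp: nbrs_def)
  then show thesis using that[of f] adj_sym[of u f] by blast
qed

text \<open>
  After a local exchange the missing edge of \<open>C\<close> is still there, so the new vertex \<open>u\<close> cannot miss
  a further one.
\<close>

lemma settled_if_missing:
  assumes "tight X" "C \<in> bad X" "missing C"
  shows "settled X C"
  unfolding settled_def complete_to_def
proof (intro conjI ballI impI)
  fix u c assume u: "u \<in> X" "card (nbrs u C) \<ge> 3" and c: "c \<in> C"
  obtain f where f: "full f C" "adj f u" using obtain_full_nbr[OF assms(2) u(2)] .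
  have nc: "near_clique (insert u (C - {f}))"
    using local_swap(2)[OF assms(1,2) u f] by (rule badD)
  obtain x y where xy: "x \<in> C - {f}" "y \<in> C - {f}" "x \<noteq> y" "\<not> adj x y"
    using missing_Diff_full[OF assms(3) f(1)] by (auto simp: missing_def)
  have uC: "u \<notin> C" using u(1) badD(2)[OF assms(2)] by blast
  show "adj u c"
  proof (cases "c = f")
    case True
    then show ?thesis using adj_sym[OF f(2)] by simp
  next
    case False
    show ?thesis
    proof (rule ccontr)
      assume nadj: "\<not> adj u c"
      have "u \<noteq> c" "c \<in> insert u (C - {f})" using uC c False by auto
      then have "{x, y} = {u, c}"
        using near_clique_unique[OF nc insertI2[OF xy(1)] insertI2[OF xy(2)] xy(3,4) insertI1 _ _ nadj]
        by metis
      then have "u = x \<or> u = y" by (metis insertI1 insertE singletonD)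
      then show False using xy(1,2) uC by (metis DiffD1)
    qed
  qed
qed (use assms in auto)

text \<open>
  An unsettled \<open>C\<close> is a clique, and some \<open>u\<close> misses exactly one of its vertices. Exchanging \<open>u\<close> into the
  bad set turns this into the missing edge that \<open>settled_if_missing\<close> asks for.
\<close>

lemma settle:
  assumes "tight X" "C \<in> bad X" "\<not> settled X C"
  obtains u w where "u \<in> X" "card (nbrs u C) \<ge> 3" "w \<in> C" "full w C" "adj w u"
    "missing (insert u (C - {w}))" "settled (swap X u w) (insert u (C - {w}))"
proof -
  have comp: "\<not> missing C" using settled_if_missing assms by blast
  obtain u z where u: "u \<in> X" "card (nbrs u C) \<ge> 3" and z: "z \<in> C" "\<not> adj u z"
    using assms by (auto simp: settled_def complete_to_def)
  obtain w where w: "full w C" "adj w u" using obtain_full_nbr[OF assms(2) u(2)] .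
  have "missing (insert u (C - {w}))"
  proof -
    have "z \<noteq> w" using z(2) adj_sym[OF w(2)] by blast
    moreover have "u \<noteq> z" using z(1) u(1) badD(2)[OF assms(2)] by blast
    ultimately show ?thesis using z unfolding missing_def by blast
  qed
  moreover from this have "settled (swap X u w) (insert u (C - {w}))"
    using settled_if_missing local_swap[OF assms(1,2) u w] by blast
  ultimately show thesis using that u w by (auto simp: full_def)
qed

text \<open>
  Once \<open>u\<close> is exchanged for a full vertex of \<open>C\<close>, its \<open>q\<close> neighbours in the rest of \<open>C\<close> exhaust the
  outer degree bound.
\<close>

lemma complete_to_outer_nbrs:
  assumes "tight X" "C \<in> bad X" "u \<in> X" "complete_to u C"
  shows "nbrs u (V - X) \<subseteq> C"
proof -
  have X: "X \<in> \<X>" "X \<subseteq> V" using assms(1) subset_V by (auto simp: tight_def)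
  note C = badD[OF assms(2)]
  obtain f where f: "full f C" using obtain_full[OF C(4), of "{}"] C(3) q_ge_4 by auto
  have "nbrs u C = C" using assms(4) by (auto simp: complete_to_def nbrs_def)
  then have u: "card (nbrs u C) \<ge> 3" using C q_ge_4 by simp
  have fu: "adj f u" using f assms(4) adj_sym[of u f] by (auto simp: complete_to_def full_def)
  have fV: "f \<in> V - X" using f C by (auto simp: full_def)
  note X' = local_swap(1)[OF assms(1-3) u f fu]
  have out: "V - swap X u f = insert u (V - X - {f})" using outside_swap[OF X(2) assms(3) fV] .
  have "card (nbrs u (V - swap X u f)) \<le> q"
    using outer_degree_le[of "swap X u f" u] X' out X assms(3) by (auto simp: tight_def)
  moreover have "C - {f} \<subseteq> nbrs u (V - swap X u f)"
    using assms(4) C out by (auto simp: complete_to_def nbrs_def)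
  moreover have "card (C - {f}) = q" using C f by (simp add: full_def)
  ultimately have "nbrs u (V - swap X u f) = C - {f}"
    using finite_V card_seteq[of "nbrs u (V - swap X u f)" "C - {f}"] by simp
  moreover have "nbrs u (V - X) \<subseteq> insert f (nbrs u (V - swap X u f))" using out by (auto simp: nbrs_def)
  ultimately show ?thesis using f by (auto simp: full_def)
qed

lemma no_joined_clique:
  assumes "X \<in> \<X>" "C \<in> bad X" "P \<subseteq> X" "card P + 1 = p"
    and "\<And>u. u \<in> P \<Longrightarrow> complete_to u C"
    and clique: "\<And>u w. u \<in> P \<Longrightarrow> w \<in> P \<Longrightarrow> u \<noteq> w \<Longrightarrow> adj u w"
  shows False
proof -
  note C = badD[OF assms(2)]
  have PV: "P \<subseteq> V" using assms(1,3) subset_V by blast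
  have "P \<inter> C = {}" using assms(3) C by blast
  then have "card (P \<union> C) = p + q"
    using assms(4) C finite_subset_V[OF PV] by (simp add: card_Un_disjoint)
  moreover obtain x y where xy: "\<And>a b. a \<in> C \<Longrightarrow> b \<in> C \<Longrightarrow> a \<noteq> b \<Longrightarrow> adj a b \<or> {a, b} = {x, y}"
    using C(4) unfolding near_clique_def by blast
  have "near_clique (P \<union> C)"
  proof (rule near_clique_if_missing)
    fix a b assume "a \<in> P \<union> C" "b \<in> P \<union> C" "a \<noteq> b"
    then consider "a \<in> P" "b \<in> P" | "a \<in> P" "b \<in> C" | "a \<in> C" "b \<in> P" | "a \<in> C" "b \<in> C"
      by blast
    then show "adj a b \<or> {a, b} = {x, y}"
    proof cases
      case 1
      then show ?thesis using clique \<open>a \<noteq> b\<close> by blast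
    next
      case 2
      then show ?thesis using assms(5) by (auto simp: complete_to_def)
    next
      case 3
      then show ?thesis using assms(5)[of b] adj_sym[of b a] by (auto simp: complete_to_def)
    next
      case 4
      then show ?thesis using xy \<open>a \<noteq> b\<close> by blast
    qed
  qed
  ultimately show False using no_large_near_clique[of "P \<union> C"] PV C by blast
qed

text \<open>
  If all neighbours of \<open>f\<close> in \<open>X\<close> were near, they would all be adjacent to all of \<open>C\<close>. The same holds
  after the exchange of one of them, \<open>u\<close>, for \<open>f\<close>, since the new bad set still has a missing edge. So
  each other one, \<open>w\<close>, is adjacent to \<open>u\<close>, and \<open>no_joined_clique\<close> applies.
\<close>

lemma far_nbr_if_missing:
  assumes "tight X" "C \<in> bad X" "missing C" "full f C"
  shows "\<exists>u\<in>X. adj f u \<and> card (nbrs u C) < 3"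
proof (rule ccontr)
  assume no: "\<not> ?thesis"
  then have near: "card (nbrs u C) \<ge> 3" if "u \<in> nbrs f X" for u
    using that by (force simp: nbrs_def)
  note C = badD[OF assms(2)]
  have X: "X \<in> \<X>" using assms(1) by (simp add: tight_def)
  have joined: "complete_to u C" if "u \<in> nbrs f X" for u
    using settled_if_missing[OF assms(1-3)] near[OF that] that by (auto simp: settled_def nbrs_def)
  have "adj u w" if u: "u \<in> nbrs f X" and w: "w \<in> nbrs f X" and "u \<noteq> w" for u w
  proof -
    have uX: "u \<in> X" "adj f u" using u by (auto simp: nbrs_def)
    let ?C = "insert u (C - {f})"
    note X' = local_swap[OF assms(1,2) uX(1) near[OF u] assms(4) uX(2)]
    have "missing ?C" using missing_Diff_full[OF assms(3,4)] by (auto simp: missing_def)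
    then have "settled (swap X u f) ?C" using settled_if_missing X' by blast
    moreover have "w \<in> swap X u f" using w \<open>u \<noteq> w\<close> by (auto simp: swap_def nbrs_def)
    moreover have "card (nbrs w ?C) \<ge> 3"
    proof -
      have "C - {f} \<subseteq> nbrs w ?C" using joined[OF w] by (auto simp: complete_to_def nbrs_def)
      then have "card (C - {f}) \<le> card (nbrs w ?C)" using C by (intro card_mono) auto
      then show ?thesis using C assms(4) q_ge_4 by (simp add: full_def)
    qed
    ultimately have "complete_to w ?C" by (simp add: settled_def)
    then show ?thesis using adj_sym[of w u] by (auto simp: complete_to_def)
  qed
  then show False
    using no_joined_clique[OF X assms(2) nbrs_subset full_nbrs(2)[OF X assms(2,4)] joined] by blast
qed

text \<open>
  When \<open>C\<close> is a clique, two nonadjacent near neighbours \<open>u\<close> and \<open>w\<close> of \<open>f\<close> can be brought into the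
  bad set one after the other. The result is a bad set with the missing edge \<open>u w\<close> in which \<open>f\<close> is
  full and still has no far neighbour, contradicting \<open>far_nbr_if_missing\<close>.
\<close>

lemma far_nbr:
  assumes "settled X C" "full f C"
  shows "\<exists>u\<in>X. adj f u \<and> card (nbrs u C) < 3"
proof (rule ccontr)
  assume no: "\<not> ?thesis"
  then have near: "card (nbrs u C) \<ge> 3" if "u \<in> nbrs f X" for u
    using that by (force simp: nbrs_def)
  have tight: "tight X" and bad: "C \<in> bad X" using assms(1) by (auto simp: settled_def)
  note C = badD[OF bad]
  have X: "X \<in> \<X>" using tight by (simp add: tight_def)
  have joined: "complete_to u C" if "u \<in> nbrs f X" for u
    using assms(1) near[OF that] that by (auto simp: settled_def nbrs_def)
  have comp: "\<not> missing C" using far_nbr_if_missing[OF tight bad _ assms(2)] no by blast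
  have fC: "f \<in> C" using assms(2) by (simp add: full_def)
  have "adj u w" if u: "u \<in> nbrs f X" and w: "w \<in> nbrs f X" and "u \<noteq> w" for u w
  proof (rule ccontr)
    assume nadj: "\<not> adj u w"
    have uX: "u \<in> X" "adj f u" and wX: "w \<in> X" "adj f w" using u w by (auto simp: nbrs_def)
    then have "u \<notin> C" "w \<notin> C" using C by auto
    have "card (C - {f}) \<ge> 2" using C fC q_ge_4 by simp
    then obtain S where "S \<subseteq> C - {f}" "card S = 2" by (meson obtain_subset_with_card_n)
    then obtain v v' where v: "v \<in> C" "v \<noteq> f" and v': "v' \<in> C" "v' \<noteq> f" and "v \<noteq> v'"
      by (auto simp: card_2_iff)
    have full: "full c C" if "c \<in> C" for c using full_if_not_missing[OF comp that] .
    have adj: "adj c a" "adj a c" if "c \<in> C" "a \<in> nbrs f X" for a c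
      using joined[OF that(2)] that(1) adj_sym[of a c] by (auto simp: complete_to_def)
    let ?X1 = "swap X u v" and ?C1 = "insert u (C - {v})"
    let ?X2 = "swap ?X1 w v'" and ?C2 = "insert w (?C1 - {v'})"
    note X1 = local_swap[OF tight bad uX(1) near[OF u] full[OF v(1)] adj(1)[OF v(1) u]]
    have full1: "full v' ?C1"
      using full[OF v'(1)] v' \<open>v \<noteq> v'\<close> adj(1)[OF v'(1) u] by (auto simp: full_def)
    have many: "card (nbrs a D) \<ge> 3" if "C - {c, c'} \<subseteq> nbrs a D" "finite D" for a D c c'
    proof -
      have "card (C - {c, c'}) \<le> card (nbrs a D)" using that by (intro card_mono) auto
      moreover have "card C \<le> card (C - {c, c'}) + card {c, c'}"
        using diff_card_le_card_Diff[of "{c, c'}" C] by simp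
      moreover have "card {c, c'} \<le> 2" by (simp add: card_insert_if)
      ultimately show ?thesis using C q_ge_4 by linarith
    qed
    have "card (nbrs w ?C1) \<ge> 3"
      using adj(2)[OF _ w] C(5) by (intro many[of v v]) (auto simp: nbrs_def)
    moreover have "w \<in> ?X1" using wX \<open>u \<noteq> w\<close> by (auto simp: swap_def)
    ultimately have X2: "tight ?X2" "?C2 \<in> bad ?X2"
      using local_swap[OF X1 _ _ full1 adj(1)[OF v'(1) w]] by blast+
    have "u \<in> ?C2" using \<open>u \<notin> C\<close> v' by auto
    then have miss: "missing ?C2" using nadj \<open>u \<noteq> w\<close> unfolding missing_def by blast
    have full2: "full f ?C2"
      using assms(2) fC v v' uX wX by (auto simp: full_def)
    obtain a where a: "a \<in> ?X2" "adj f a" "card (nbrs a ?C2) < 3"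
      using far_nbr_if_missing[OF X2 miss full2] by blast
    have "a \<in> nbrs f X \<or> a = v \<or> a = v'" using a by (auto simp: swap_def nbrs_def)
    then have "C - {v, v'} \<subseteq> nbrs a ?C2"
      using adj(2) full[OF v(1)] full[OF v'(1)] by (auto simp: nbrs_def full_def)
    then show False using many[of v v' a ?C2] a C(5) by auto
  qed
  then show False
    using no_joined_clique[OF X bad nbrs_subset full_nbrs(2)[OF X bad assms(2)] joined] by blast
qed

section \<open>The walk of far exchanges\<close>

text \<open>
  A history entry \<open>(Y, D, g)\<close> records a far exchange from a member \<open>Y\<close> of the family with bad set
  \<open>D\<close>, in which the full vertex \<open>g\<close> of \<open>D\<close> entered the family member. It leaves the block \<open>D - {g}\<close> behind.
\<close>

definition blocks :: "('a set \<times> 'a set \<times> 'a) set \<Rightarrow> 'a set" where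
  "blocks Hs = (\<Union>(Y, D, g)\<in>Hs. D - {g})"

text \<open>
  What the current member \<open>X\<close> still knows about an earlier entry: the block is untouched, \<open>g\<close> has not
  come back, vertices that left the family member since then lie in blocks \<open>R\<close> or among the few recent ones \<open>N\<close>,
  and vertices other than \<open>g\<close> that joined it since then have no neighbour in the block.
\<close>

definition trace :: "'a set \<Rightarrow> 'a set \<Rightarrow> 'a set \<Rightarrow> 'a set \<Rightarrow> 'a set \<Rightarrow> 'a \<Rightarrow> bool" where
  "trace X R N Y D g \<longleftrightarrow>
     settled Y D \<and> full g D \<and> g \<in> X \<and> D - {g} \<subseteq> V - X \<and>
     V - X \<subseteq> (V - Y) \<union> R \<union> N \<and>
     (\<forall>x\<in>X - Y. x = g \<or> (\<forall>d\<in>D - {g}. \<not> adj x d))"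

definition walk :: "'a set \<Rightarrow> 'a set \<Rightarrow> 'a set \<Rightarrow> ('a set \<times> 'a set \<times> 'a) set \<Rightarrow> bool" where
  "walk X C N Hs \<longleftrightarrow> tight X \<and> C \<in> bad X \<and> N \<subseteq> C \<and> blocks Hs \<inter> C = {} \<and>
     (\<forall>(Y, D, g)\<in>Hs. trace X (blocks Hs) N Y D g)"

lemma blocks_insert: "blocks (insert (X, C, f) Hs) = (C - {f}) \<union> blocks Hs"
  by (auto simp: blocks_def)

lemma walkD:
  assumes "walk X C N Hs"
  shows "tight X" "C \<in> bad X" "N \<subseteq> C" "blocks Hs \<inter> C = {}"
    "\<And>Y D g. (Y, D, g) \<in> Hs \<Longrightarrow> trace X (blocks Hs) N Y D g"
  using assms by (auto simp: walk_def)

lemma traceD: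
  assumes "trace X R N Y D g"
  shows "settled Y D" "full g D" "g \<in> X" "D - {g} \<subseteq> V - X" "V - X \<subseteq> (V - Y) \<union> R \<union> N"
    "\<And>x d. x \<in> X \<Longrightarrow> x \<notin> Y \<Longrightarrow> x \<noteq> g \<Longrightarrow> d \<in> D \<Longrightarrow> d \<noteq> g \<Longrightarrow> \<not> adj x d"
  using assms by (auto simp: trace_def)

lemma blocks_outside:
  assumes "walk X C N Hs"
  shows "blocks Hs \<subseteq> V - X"
  using traceD(4)[OF walkD(5)[OF assms]] unfolding blocks_def by fast

lemma block_subset: "(Y, D, g) \<in> Hs \<Longrightarrow> D - {g} \<subseteq> blocks Hs"
  by (auto simp: blocks_def)

lemma settled_nbrs_outside:
  assumes "settled Y D" "full g D" "v \<in> V - Y" "v \<notin> D"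
  shows "\<not> adj g v"
proof -
  have "Y \<in> \<X>" "D \<in> bad Y" using assms(1) by (auto simp: settled_def tight_def)
  then have "nbrs g (V - Y) = D - {g}" using full_nbrs(1) assms(2) by blast
  then show ?thesis using assms(3,4) by (auto simp: nbrs_def)
qed

text \<open>
  The vertices of the current bad set outside \<open>N\<close> have been outside the family member since before the
  earlier entry, and they do not belong to its bad set. So the full vertex \<open>g\<close> of that set does not see them.
\<close>

lemma walk_fresh:
  assumes "walk X C N Hs" "(Y, D, g) \<in> Hs" "v \<in> C - N"
  shows "v \<in> V - Y" "v \<notin> D" "\<not> adj g v"
proof -
  note W = walkD[OF assms(1)]
  note t = traceD[OF W(5)[OF assms(2)]]
  have v: "v \<in> V - X" using assms(3) badD[OF W(2)] by blast
  show vY: "v \<in> V - Y" using t(5) v assms(3) W(4) by blast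
  show "v \<notin> D"
    using block_subset[OF assms(2)] W(4) assms(3) t(3) v by blast
  with vY show "\<not> adj g v" using settled_nbrs_outside[OF t(1,2)] by blast
qed

text \<open>
  The vertex \<open>u\<close> that settling brings into the bad set has at least three neighbours there, while an old
  exchanged vertex \<open>g\<close> has neighbours there only in \<open>N\<close>. Hence \<open>u \<noteq> g\<close>, and the history survives.
\<close>

lemma walk_settle:
  assumes "walk X C N Hs" "card N \<le> 1"
  obtains X' C' N' where "walk X' C' N' Hs" "card N' \<le> 2" "settled X' C'"
proof (cases "settled X C")
  case True
  then show thesis using that[of X C N] assms by simp
next
  case False
  note W = walkD[OF assms(1)]
  note C = badD[OF W(2)]
  have finN: "finite N" using W(3) C(5) finite_subset by blast
  obtain u w where u: "u \<in> X" "card (nbrs u C) \<ge> 3" and w: "w \<in> C" "full w C" "adj w u"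
    and set: "settled (swap X u w) (insert u (C - {w}))"
    using settle[OF W(1,2) False] by blast
  let ?X = "swap X u w" and ?C = "insert u (C - {w})"
  have X: "X \<in> \<X>" "X \<subseteq> V" using W(1) subset_V by (auto simp: tight_def)
  have wV: "w \<in> V - X" using w C by blast
  have out: "V - ?X = insert u (V - X - {w})" using outside_swap[OF X(2) u(1) wV] .
  have wn: "\<not> adj w v" if "v \<in> V - X" "v \<notin> C" for v
    using full_nbrs(1)[OF X(1) W(2) w(2)] that by (auto simp: nbrs_def)
  have tr: "trace ?X (blocks Hs) (insert u (N - {w})) Y D g" if h: "(Y, D, g) \<in> Hs" for Y D g
  proof -
    note t = traceD[OF W(5)[OF h]]
    have DC: "(D - {g}) \<inter> C = {}" using block_subset[OF h] W(4) by blast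
    have "g \<noteq> u"
    proof
      assume "g = u"
      then have "nbrs u C \<subseteq> N" using walk_fresh(3)[OF assms(1) h] by (auto simp: nbrs_def)
      then have "card (nbrs u C) \<le> card N" using finN by (intro card_mono)
      then show False using u assms(2) by simp
    qed
    moreover have "\<not> adj w d" if "d \<in> D" "d \<noteq> g" for d using wn[of d] t(4) DC that by blast
    ultimately show ?thesis
      unfolding trace_def using t out DC w(1) u(1) by (auto simp: swap_def)
  qed
  have "u \<notin> blocks Hs" using blocks_outside[OF assms(1)] u by blast
  then have "walk ?X ?C (insert u (N - {w})) Hs"
    unfolding walk_def using W set tr by (auto simp: settled_def)
  moreover have "card (insert u (N - {w})) \<le> 2"
    using assms(2) finN card_mono[of N "N - {w}"] by (auto simp: card_insert_if)
  ultimately show thesis using that set by blast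
qed

text \<open>
  The bound \<open>card N \<le> 2\<close> leaves a full vertex \<open>f\<close> outside \<open>N\<close>, since at least \<open>q - 1 \<ge> 3\<close> vertices of \<open>C\<close>
  are full. Choosing \<open>f\<close> outside \<open>N\<close> ensures that it was already outside every earlier family member,
  which is what excludes a return to an earlier block.
\<close>

lemma walk_step:
  assumes "walk X C N Hs" "card N \<le> 2" "settled X C"
  obtains X' C' N' f where "f \<in> C" "walk X' C' N' (insert (X, C, f) Hs)" "card N' \<le> 1"
proof -
  note W = walkD[OF assms(1)]
  note C = badD[OF W(2)]
  have finN: "finite N" using W(3) C(5) finite_subset by blast
  obtain f where f: "full f C" "f \<notin> N"
    using obtain_full[OF C(4) finN] C(3) q_ge_4 assms(2) by auto
  have fC: "f \<in> C" using f by (simp add: full_def)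
  obtain u where u: "u \<in> X" "adj f u" "card (nbrs u C) < 3" using far_nbr[OF assms(3) f(1)] by blast
  let ?X = "swap X u f"
  obtain C' where C': "tight ?X" "C' \<in> bad ?X" "u \<in> C'" "C' = insert u (C - {f}) \<or> C' \<inter> C = {}"
    using tight_swap[OF W(1,2) f(1) u(1,2)] by blast
  note D' = badD[OF C'(2)]
  have X: "X \<in> \<X>" "X \<subseteq> V" and X': "?X \<in> \<X>" using W(1) C'(1) subset_V by (auto simp: tight_def)
  have fV: "f \<in> V - X" using fC C by blast
  have out: "V - ?X = insert u (V - X - {f})" using outside_swap[OF X(2) u(1) fV] .
  have many: "card (nbrs u C') \<ge> 3" using near_clique_degree[OF D'(4) C'(3) D'(5)] D'(3) q_ge_4 by simp
  have far: "C' \<inter> C = {}"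
  proof (rule ccontr)
    assume "C' \<inter> C \<noteq> {}"
    then have "C' = insert u (C - {f})" using C'(4) by blast
    then have "nbrs u C' \<subseteq> nbrs u C" using adj_irrefl by (auto simp: nbrs_def)
    then have "card (nbrs u C') \<le> card (nbrs u C)" using C(5) by (intro card_mono) auto
    then show False using many u(3) by simp
  qed
  have fn: "\<not> adj f v" if "v \<in> V - X" "v \<notin> C" for v
    using full_nbrs(1)[OF X(1) W(2) f(1)] that by (auto simp: nbrs_def)
  have ug: "u \<noteq> g" if h: "(Y, D, g) \<in> Hs" for Y D g
    using walk_fresh(3)[OF assms(1) h, of f] fC f(2) u(2) adj_sym[of f u] by blast
  have new: "C' \<inter> (D - {g}) = {}" if h: "(Y, D, g) \<in> Hs" for Y D g
  proof (rule ccontr)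
    assume meet: "C' \<inter> (D - {g}) \<noteq> {}"
    note t = traceD[OF W(5)[OF h]]
    have Y: "tight Y" "D \<in> bad Y" using t(1) by (auto simp: settled_def)
    note D = badD[OF Y(2)]
    have fD: "f \<in> V - Y" "f \<notin> D" using walk_fresh[OF assms(1) h, of f] fC f(2) by auto
    have gD: "g \<in> D" using t(2) by (simp add: full_def)
    \<comment> \<open>A return absorbs the whole block, and \<open>u\<close> is the only further vertex.\<close>
    have "D - {g} \<subseteq> V - ?X" using t(4) fD out by auto
    then have sub: "D - {g} \<subseteq> C'"
      using bad_absorbs[OF X' C'(2), of "D - {g}"] near_clique_subset[OF D(4), of "D - {g}"] D gD meet
      by auto
    have "u \<notin> D - {g}" using t(4) u(1) by blast
    then have "card (insert u (D - {g})) = card C'" using D D' gD by simp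
    then have eq: "insert u (D - {g}) = C'"
      using card_subset_eq[OF D'(5), of "insert u (D - {g})"] sub C'(3) by simp
    \<comment> \<open>So \<open>u\<close> has many neighbours in \<open>D\<close>. As \<open>D\<close> is settled, all outer neighbours that \<open>u\<close> had at the time
      of \<open>Y\<close> are in \<open>D\<close>, but \<open>f\<close> is one of them and is not in \<open>D\<close>.\<close>
    have sub': "nbrs u C' \<subseteq> nbrs u D - {g}" using eq adj_irrefl by (auto simp: nbrs_def)
    then have "card (nbrs u C') \<le> card (nbrs u D)" using D(5) by (intro card_mono) auto
    then have manyD: "card (nbrs u D) \<ge> 3" using many by simp
    have "nbrs u C' \<noteq> {}" using many by auto
    then obtain d where "d \<in> D" "d \<noteq> g" "adj u d" using sub' by (auto simp: nbrs_def)
    then have uY: "u \<in> Y" using t(6)[OF u(1)] ug[OF h] by blast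
    then have "complete_to u D" using t(1) manyD by (simp add: settled_def)
    then have "nbrs u (V - Y) \<subseteq> D" using complete_to_outer_nbrs[OF Y uY] by blast
    then show False using fD adj_sym[OF u(2)] by (auto simp: nbrs_def)
  qed
  let ?Hs = "insert (X, C, f) Hs"
  have "trace ?X (blocks ?Hs) {u} X C f"
    unfolding trace_def using assms(3) f fC u(1) C out by (auto simp: swap_def)
  moreover have "trace ?X (blocks ?Hs) {u} Y D g" if h: "(Y, D, g) \<in> Hs" for Y D g
  proof -
    note t = traceD[OF W(5)[OF h]]
    have DC: "(D - {g}) \<inter> C = {}" using block_subset[OF h] W(4) by blast
    have "V - ?X \<subseteq> (V - Y) \<union> blocks ?Hs \<union> {u}"
    proof
      fix v assume v: "v \<in> V - ?X"
      show "v \<in> (V - Y) \<union> blocks ?Hs \<union> {u}"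
      proof (cases "v = u")
        case False
        then have "v \<in> V - X" using v out by auto
        then have "v \<in> (V - Y) \<union> blocks Hs \<union> N" using t(5) by blast
        moreover have "v \<noteq> f" using v by (auto simp: swap_def)
        ultimately show ?thesis using W(3) unfolding blocks_insert by blast
      qed simp
    qed
    moreover have "\<not> adj f d" if "d \<in> D" "d \<noteq> g" for d using fn[of d] t(4) DC that by blast
    ultimately show ?thesis
      unfolding trace_def using t DC fC u(1) ug[OF h] out by (auto simp: swap_def)
  qed
  moreover have "blocks ?Hs \<inter> C' = {}"
    unfolding blocks_insert blocks_def using far new by fast
  ultimately have "walk ?X C' {u} ?Hs"
    unfolding walk_def using C' by auto
  then show thesis using that[of f ?X C' "{u}"] fC by simp
qed

text \<open>Each step adds a new nonempty block, which cannot go on in a finite vertex set.\<close>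

lemma no_walk:
  assumes "walk X C N Hs" "card N \<le> 1"
  shows False
  using assms
proof (induction "card (V - blocks Hs)" arbitrary: X C N Hs rule: less_induct)
  case less
  obtain X1 C1 N1 where 1: "walk X1 C1 N1 Hs" "card N1 \<le> 2" "settled X1 C1"
    using walk_settle[OF less.prems] .
  obtain X2 C2 N2 f where 2: "f \<in> C1" "walk X2 C2 N2 (insert (X1, C1, f) Hs)" "card N2 \<le> 1"
    using walk_step[OF 1] .
  note C = badD[OF walkD(2)[OF 1(1)]]
  have "card (C1 - {f}) > 0" using C 2(1) q_ge_4 by simp
  then obtain c where "c \<in> C1 - {f}" by (auto simp: card_gt_0_iff)
  then have "V - blocks (insert (X1, C1, f) Hs) \<subset> V - blocks Hs"
    unfolding blocks_insert using C(1) walkD(4)[OF 1(1)] by blast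
  then have "card (V - blocks (insert (X1, C1, f) Hs)) < card (V - blocks Hs)"
    using finite_V by (intro psubset_card_mono) auto
  then show False using less.hyps 2 by blast
qed

theorem ex_member_without_bad: "\<exists>X\<in>\<X>. bad X = {}"
proof -
  obtain X where X: "X \<in> \<X>" and min: "\<And>Y. Y \<in> \<X> \<Longrightarrow> card (bad X) \<le> card (bad Y)"
    using family_nonempty ex_has_least_nat[of "\<lambda>X. X \<in> \<X>" _ "\<lambda>X. card (bad X)"] by blast
  have "bad X = {}"
  proof (rule ccontr)
    assume "bad X \<noteq> {}"
    then obtain C where "C \<in> bad X" by blast
    then have "walk X C {} {}" using X min by (simp add: walk_def tight_def blocks_def)
    then show False using no_walk[of X C "{}" "{}"] by simp
  qed
  then show ?thesis using X by blast
qed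

end

section \<open>Copies, degrees and cliques in graphs\<close>

lemma subgraph_restrict_smaller:
  assumes "subgraph S (H \<restriction> W)" "v \<notin> verts S" "W \<subseteq> insert v X" "wf_digraph H"
  shows "subgraph S (H \<restriction> X)"
proof -
  interpret S: wf_digraph S using assms(1) by (simp add: subgraph_def)
  have ends: "tail S = tail H" "head S = head H"
    using assms(1) by (auto simp: subgraph_def compatible_def)
  have "verts S \<subseteq> X" using assms(1-3) by (auto simp: subgraph_def)
  moreover have "arcs S \<subseteq> arcs H" using assms(1) by (auto simp: subgraph_def)
  moreover have "tail H e \<in> verts S" "head H e \<in> verts S" if "e \<in> arcs S" for e
    using that S.tail_in_verts S.head_in_verts ends by auto
  ultimately show ?thesis
    using ends S.wf_digraph_axioms wf_digraph.wellformed_induce_subgraph[OF assms(4)]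
    by (auto simp: subgraph_def compatible_def)
qed

lemma out_degree_eq_card_nbrs:
  assumes "digraph G"
  shows "out_degree G v = card {w. (v, w) \<in> arcs_ends G}"
proof -
  interpret digraph G by fact
  have "inj_on (head G) (out_arcs G v)"
    using no_multi_arcs by (auto simp: inj_on_def out_arcs_def arc_to_ends_def)
  moreover have "{w. (v, w) \<in> arcs_ends G} = head G ` out_arcs G v"
    by (auto simp: out_arcs_def arcs_ends_conv)
  ultimately show ?thesis by (simp add: out_degree_def card_image)
qed

lemma arcs_ends_restrict: "arcs_ends (H \<restriction> W) = {(u, v) \<in> arcs_ends H. u \<in> W \<and> v \<in> W}"
  by (auto simp: arcs_ends_conv)

lemma arcs_ends_subgraph:
  assumes "subgraph S H"
  shows "arcs_ends S \<subseteq> arcs_ends H \<inter> verts S \<times> verts S"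
proof -
  interpret S: wf_digraph S using assms by (simp add: subgraph_def)
  have "tail S = tail H" "head S = head H" "arcs S \<subseteq> arcs H"
    using assms by (auto simp: subgraph_def compatible_def)
  then show ?thesis using S.tail_in_verts S.head_in_verts by (force simp: arcs_ends_conv)
qed

lemma iso_min_degree:
  assumes "fin_digraph G" "digraph_iso G S" "w \<in> verts S"
  shows "min_degree G \<le> out_degree S w"
proof -
  interpret fin_digraph G by fact
  obtain f where f: "digraph_isomorphism f" "S = app_iso f G"
    using assms(2) by (auto simp: digraph_iso_def)
  then obtain v where v: "v \<in> verts G" "w = iso_verts f v" using assms(3) by auto
  have "out_degree S w = out_degree G v" using f v by (simp add: out_degree_app_iso_eq)
  moreover have "min_degree G \<le> out_degree G v" using v by (simp add: min_degree_def)
  ultimately show ?thesis by simp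
qed

text \<open>
  Choose an arc of \<open>H\<close> between the images of the ends of each arc of \<open>K\<close>. Since \<open>K\<close> has no parallel
  arcs, this choice is injective, and the chosen arcs form the required subgraph.
\<close>

lemma not_graph_free_if_embeds:
  assumes K: "nomulti_digraph K" and H: "wf_digraph H"
    and g: "inj_on g (verts K)" "g ` verts K \<subseteq> verts H"
    and arcs: "\<And>i j. (i, j) \<in> arcs_ends K \<Longrightarrow> (g i, g j) \<in> arcs_ends H"
  shows "\<not> graph_free K H"
proof -
  interpret K: nomulti_digraph K by fact
  interpret H: wf_digraph H by fact
  have "\<exists>e\<in>arcs H. tail H e = g (tail K a) \<and> head H e = g (head K a)" if "a \<in> arcs K" for a
    using arcs[of "tail K a" "head K a"] that by (force simp: arcs_ends_conv)
  then obtain h where h: "\<And>a. a \<in> arcs K \<Longrightarrow>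
      h a \<in> arcs H \<and> tail H (h a) = g (tail K a) \<and> head H (h a) = g (head K a)"
    by metis
  let ?f = "\<lparr> iso_verts = g, iso_arcs = h, iso_head = head H, iso_tail = tail H \<rparr>"
  have "inj_on h (arcs K)"
  proof (rule inj_onI)
    fix a b assume ab: "a \<in> arcs K" "b \<in> arcs K" "h a = h b"
    then have "g (tail K a) = g (tail K b)" "g (head K a) = g (head K b)" using h by metis+
    then have "arc_to_ends K a = arc_to_ends K b"
      using g(1) ab by (simp add: arc_to_ends_def inj_on_eq_iff)
    then show "a = b" using K.no_multi_arcs ab by blast
  qed
  then have iso: "K.digraph_isomorphism ?f"
    using g h K.wf_digraph_axioms by (simp add: K.digraph_isomorphism_def)
  have "subgraph (app_iso ?f K) H"
    using g h H.wf_digraph_axioms K.wf_digraphI_app_iso[OF iso]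
    by (auto simp: subgraph_def compatible_def)
  then show ?thesis using iso unfolding graph_free_def digraph_iso_def by blast
qed

text \<open>
  Number the vertices of \<open>W\<close> so that the possibly nonadjacent ones come first, matching the
  edge that is removed from the complete graph.
\<close>

lemma graph_free_no_near_clique:
  assumes H: "graph H" and free: "graph_free (complete_graph_minus_edge n) H"
    and W: "W \<subseteq> verts H" "card W = n" "n \<ge> 2"
    and near: "\<And>a b. a \<in> W \<Longrightarrow> b \<in> W \<Longrightarrow> a \<noteq> b \<Longrightarrow> (a, b) \<in> arcs_ends H \<or> {a, b} = {x, y}"
  shows False
proof -
  interpret H: graph H by fact
  have fin: "finite W" using W H.finite_verts finite_subset by blast
  \<comment> \<open>If \<open>x\<close> and \<open>y\<close> are not two vertices of \<open>W\<close>, then \<open>W\<close> is a clique and any pair will do.\<close>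
  obtain x' y' where xy: "x' \<in> W" "y' \<in> W" "x' \<noteq> y'"
    and near': "\<And>a b. a \<in> W \<Longrightarrow> b \<in> W \<Longrightarrow> a \<noteq> b \<Longrightarrow> (a, b) \<in> arcs_ends H \<or> {a, b} = {x', y'}"
  proof (cases "x \<in> W \<and> y \<in> W \<and> x \<noteq> y")
    case True
    then show thesis using that[of x y] near by blast
  next
    case False
    obtain S where "S \<subseteq> W" "card S = 2" using W by (meson obtain_subset_with_card_n)
    then obtain a b where ab: "a \<in> W" "b \<in> W" "a \<noteq> b" by (auto simp: card_2_iff)
    have "(c, d) \<in> arcs_ends H" if "c \<in> W" "d \<in> W" "c \<noteq> d" for c d
      using near[OF that] False that by (auto simp: doubleton_eq_iff)
    then show thesis using that[OF ab] by blast
  qed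
  have "card {2..<n} = card (W - {x', y'})"
    using W fin xy by (simp add: card_Diff_subset)
  then obtain h where h: "bij_betw h {2..<n} (W - {x', y'})"
    using fin finite_same_card_bij[of "{2..<n}" "W - {x', y'}"] by auto
  define g where "g i = (if i = 0 then x' else if i = 1 then y' else h i)" for i :: nat
  have hW: "h i \<in> W" "h i \<noteq> x'" "h i \<noteq> y'" if "2 \<le> i" "i < n" for i
    using bij_betwE[OF h] that by auto
  have inj: "inj_on g {..<n}"
  proof (rule inj_onI)
    fix i j assume ij: "i \<in> {..<n}" "j \<in> {..<n}" "g i = g j"
    have h_inj: "i = j" if "2 \<le> i" "2 \<le> j" "h i = h j"
      using h that ij by (auto simp: bij_betw_def inj_on_def)
    have "i = 0 \<or> i = 1 \<or> 2 \<le> i" "j = 0 \<or> j = 1 \<or> 2 \<le> j" by auto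
    then show "i = j"
      using ij xy hW[of i] hW[of j] h_inj unfolding g_def by (auto split: if_splits)
  qed
  have gW: "g i \<in> W" if "i < n" for i
    using xy hW[of i] that by (auto simp: g_def)
  have "\<not> graph_free (complete_graph_minus_edge n) H"
  proof (rule not_graph_free_if_embeds[of _ _ g])
    show "nomulti_digraph (complete_graph_minus_edge n)"
      using graph_complete_graph_minus_edge[of n] by (simp add: graph_def digraph_def)
    show "inj_on g (verts (complete_graph_minus_edge n))"
      using inj by (simp add: complete_graph_minus_edge_def)
    show "g ` verts (complete_graph_minus_edge n) \<subseteq> verts H"
      using gW W by (auto simp: complete_graph_minus_edge_def)
    fix i j assume "(i, j) \<in> arcs_ends (complete_graph_minus_edge n)"
    then have ij: "i < n" "j < n" "i \<noteq> j" "(i, j) \<noteq> (0, 1)" "(i, j) \<noteq> (1, 0)"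
      by (auto simp: complete_graph_minus_edge_def)
    have "g i \<noteq> g j" using inj ij by (auto simp: inj_on_def)
    moreover have "{g i, g j} \<noteq> {x', y'}"
    proof
      assume "{g i, g j} = {x', y'}"
      then have "{g i, g j} = {g 0, g 1}" by (simp add: g_def)
      then have "(g i = g 0 \<and> g j = g 1) \<or> (g i = g 1 \<and> g j = g 0)" by (auto simp: doubleton_eq_iff)
      moreover have "0 \<in> {..<n}" "1 \<in> {..<n}" using W by auto
      ultimately have "(i = 0 \<and> j = 1) \<or> (i = 1 \<and> j = 0)"
        using inj ij by (metis inj_onD lessThan_iff)
      then show False using ij by auto
    qed
    ultimately show "(g i, g j) \<in> arcs_ends H" using near' gW ij by blast
  qed (use H.wf_digraph_axioms in simp)
  then show False using free by blast
qed

text \<open>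
  The neighbours of a common vertex of two \<open>q\<close>-cliques include the rest of their union, so the union
  has at most \<open>q + 1\<close> vertices. If the cliques are distinct, each has exactly one vertex outside the other,
  and this is the only pair that may be nonadjacent.
\<close>

lemma cliques_disjoint_if_no_bad_set:
  assumes G: "digraph G" and deg: "max_degree G \<le> q"
    and no: "\<And>W x y. W \<subseteq> verts G \<Longrightarrow> card W = Suc q \<Longrightarrow>
      (\<And>a b. a \<in> W \<Longrightarrow> b \<in> W \<Longrightarrow> a \<noteq> b \<Longrightarrow> (a, b) \<in> arcs_ends G \<or> {a, b} = {x, y}) \<Longrightarrow> False"
  shows "cliques_disjoint q G"
  unfolding cliques_disjoint_def
proof (intro ballI impI)
  interpret G: digraph G by fact
  fix S T assume S: "S \<in> cliques q G" and T: "T \<in> cliques q G" and "S \<noteq> T"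
  have props: "verts R \<subseteq> verts G" "finite (verts R)" "card (verts R) = q"
    "\<And>a b. a \<in> verts R \<Longrightarrow> b \<in> verts R \<Longrightarrow> a \<noteq> b \<Longrightarrow> (a, b) \<in> arcs_ends G"
    "arcs R = {e \<in> arcs G. tail G e \<in> verts R \<and> head G e \<in> verts R}"
    "tail R = tail G" "head R = head G"
    if "R \<in> cliques q G" for R
  proof -
    have sub: "subgraph R G" and comp: "complete_digraph q R" using that by (auto simp: cliques_def)
    have ends: "arcs_ends R = {(u, v). (u, v) \<in> verts R \<times> verts R \<and> u \<noteq> v}"
      using comp by (simp add: complete_digraph_def)
    interpret R: wf_digraph R using sub by (simp add: subgraph_def)
    show t: "tail R = tail G" "head R = head G" using sub by (auto simp: subgraph_def compatible_def)
    show "verts R \<subseteq> verts G" using sub by (simp add: subgraph_def)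
    then show "finite (verts R)" using G.finite_verts finite_subset by blast
    show "card (verts R) = q" using comp by (simp add: complete_digraph_def)
    show "(a, b) \<in> arcs_ends G" if "a \<in> verts R" "b \<in> verts R" "a \<noteq> b" for a b
      using arcs_ends_subgraph[OF sub] ends that by blast
    have aR: "arcs R \<subseteq> arcs G" using sub by (simp add: subgraph_def)
    show "arcs R = {e \<in> arcs G. tail G e \<in> verts R \<and> head G e \<in> verts R}"
    proof (intro equalityI subsetI)
      fix e assume "e \<in> arcs R"
      then show "e \<in> {e \<in> arcs G. tail G e \<in> verts R \<and> head G e \<in> verts R}"
        using aR R.tail_in_verts R.head_in_verts t by auto
    next
      fix e assume e: "e \<in> {e \<in> arcs G. tail G e \<in> verts R \<and> head G e \<in> verts R}"
      then have "(tail G e, head G e) \<in> arcs_ends R" using ends G.no_loops by auto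
      then obtain e' where e': "e' \<in> arcs R" "tail G e' = tail G e" "head G e' = head G e"
        using t by (auto simp: arcs_ends_conv)
      then have "e' = e" using G.no_multi_arcs[of e' e] aR e by (auto simp: arc_to_ends_def)
      then show "e \<in> arcs R" using e' by simp
    qed
  qed
  note S = props[OF S] and T = props[OF T]
  have neq: "verts S \<noteq> verts T"
  proof
    assume "verts S = verts T"
    then have "S = T" using S(5-7) T(5-7) by (intro pre_digraph.equality) auto
    then show False using \<open>S \<noteq> T\<close> by blast
  qed
  show "verts S \<inter> verts T = {}"
  proof (rule ccontr)
    assume "verts S \<inter> verts T \<noteq> {}"
    then obtain v where v: "v \<in> verts S" "v \<in> verts T" by blast
    let ?W = "verts S \<union> verts T"
    have "?W - {v} \<subseteq> {w. (v, w) \<in> arcs_ends G}" using S(4) T(4) v by blast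
    moreover have "finite {w. (v, w) \<in> arcs_ends G}"
      by (rule finite_subset[OF _ G.finite_verts]) (auto simp: arcs_ends_conv)
    ultimately have "card (?W - {v}) \<le> out_degree G v"
      using out_degree_eq_card_nbrs[OF G.digraph_axioms] by (metis card_mono)
    also have "\<dots> \<le> max_degree G"
      unfolding max_degree_def using v S(1) by (intro Max_ge) auto
    finally have le: "card ?W \<le> Suc q" using deg v S(2) T(2) by (simp add: card_Diff_singleton)
    have "\<not> verts T \<subseteq> verts S" "\<not> verts S \<subseteq> verts T"
      using neq S(2,3) T(2,3) by (metis card_subset_eq)+
    then obtain x y where xy: "x \<in> verts S" "x \<notin> verts T" "y \<in> verts T" "y \<notin> verts S" by blast
    have subS: "insert y (verts S) \<subseteq> ?W" and subT: "insert x (verts T) \<subseteq> ?W" using xy by auto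
    have card: "card (insert y (verts S)) = Suc q" "card (insert x (verts T)) = Suc q"
      using S(2,3) T(2,3) xy by auto
    then have W: "insert y (verts S) = ?W" "insert x (verts T) = ?W"
      using card_seteq[OF _ subS] card_seteq[OF _ subT] le S(2) T(2) by simp_all
    show False
    proof (rule no[of ?W x y])
      show "?W \<subseteq> verts G" using S(1) T(1) by blast
      show "card ?W = Suc q" using card(1) unfolding W(1) .
      fix a b assume ab: "a \<in> ?W" "b \<in> ?W" "a \<noteq> b"
      then have "a \<in> insert y (verts S)" "b \<in> insert y (verts S)"
        "a \<in> insert x (verts T)" "b \<in> insert x (verts T)"
        unfolding W by simp_all
      then have "(a \<in> verts S \<and> b \<in> verts S) \<or> (a \<in> verts T \<and> b \<in> verts T) \<or> {a, b} = {x, y}"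
        using ab(3) xy by auto
      then show "(a, b) \<in> arcs_ends G \<or> {a, b} = {x, y}" using S(4) T(4) ab(3) by metis
    qed
  qed
qed

lemma ex_max_order_free_induced:
  assumes "finite (verts H)" "\<And>G. G \<in> \<G> \<Longrightarrow> verts G \<noteq> {}"
  shows "\<exists>W. max_order_free_induced \<G> H W"
proof -
  have "graph_free G (H \<restriction> {})" if "G \<in> \<G>" for G
    unfolding graph_free_def digraph_iso_def using assms(2)[OF that]
    by (auto simp: subgraph_def app_iso_def)
  then have "{} \<subseteq> verts H \<and> family_free \<G> (H \<restriction> {})" by (simp add: family_free_def)
  then have "\<exists>W. (W \<subseteq> verts H \<and> family_free \<G> (H \<restriction> W)) \<and>
      (\<forall>S. S \<subseteq> verts H \<and> family_free \<G> (H \<restriction> S) \<longrightarrow> card S \<le> card W)"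
    using ex_has_greatest_nat[of "\<lambda>W. W \<subseteq> verts H \<and> family_free \<G> (H \<restriction> W)" "{}" card
        "Suc (card (verts H))"] card_mono[OF assms(1)]
    by (simp add: less_Suc_eq_le)
  then show ?thesis by (auto simp: max_order_free_induced_def)
qed

text \<open>
  A forbidden copy in \<open>W\<close> must use \<open>v\<close>, the only vertex of \<open>W\<close> that may lie outside the free set \<open>X\<close>,
  and \<open>v\<close> has degree at least \<open>d\<close> in the copy.
\<close>

lemma copy_through_vertex:
  assumes H: "graph H" and \<G>: "\<And>G. G \<in> \<G> \<Longrightarrow> graph G \<and> min_degree G \<ge> d"
    and free: "family_free \<G> (H \<restriction> X)" and notfree: "\<not> family_free \<G> (H \<restriction> W)"
    and W: "W \<subseteq> insert v X" "W \<subseteq> verts H"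
  shows "d \<le> card {w \<in> W. (v, w) \<in> arcs_ends H}"
proof -
  interpret H: graph H by fact
  obtain G S where G: "G \<in> \<G>" and S: "subgraph S (H \<restriction> W)" "digraph_iso G S"
    using notfree by (auto simp: family_free_def graph_free_def)
  have "v \<in> verts S"
  proof (rule ccontr)
    assume "v \<notin> verts S"
    then have "subgraph S (H \<restriction> X)"
      using subgraph_restrict_smaller[OF S(1) _ W(1)] H.wf_digraph_axioms by blast
    then show False using free G S(2) by (auto simp: family_free_def graph_free_def)
  qed
  then have "min_degree G \<le> out_degree S v"
    using iso_min_degree[OF _ S(2)] \<G>[OF G] by (meson graph_def digraph_def)
  moreover
  have SH: "subgraph S H"
    using S(1) H.wf_digraph_axioms W(2) by (auto simp: subgraph_def compatible_def)
  have "out_degree S v = card {w. (v, w) \<in> arcs_ends S}"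
    by (rule out_degree_eq_card_nbrs[OF H.digraph_subgraph[OF SH]])
  moreover have "card {w. (v, w) \<in> arcs_ends S} \<le> card {w \<in> W. (v, w) \<in> arcs_ends H}"
  proof (rule card_mono)
    show "finite {w \<in> W. (v, w) \<in> arcs_ends H}"
      by (rule finite_subset[OF _ H.finite_verts]) (auto simp: arcs_ends_conv)
    show "{w. (v, w) \<in> arcs_ends S} \<subseteq> {w \<in> W. (v, w) \<in> arcs_ends H}"
      using arcs_ends_subgraph[OF S(1)] by (auto simp: arcs_ends_restrict)
  qed
  ultimately show ?thesis using \<G>[OF G] by linarith
qed

section \<open>The partition\<close>

theorem theorem1p1:
  fixes H :: "('a,'b) pre_digraph"
    and \<G> :: "('c,'d) pre_digraph set"
    and p q :: nat
  assumes "graph H"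
    and "connected H"
    and "max_degree H \<ge> 5"
    and "graph_free (complete_graph_minus_edge (max_degree H + 1)) H"
    and "p \<ge> 2"
    and "q \<ge> 4"
    and "max_degree H + 1 = p + q"
    and "\<And>G. G \<in> \<G> \<Longrightarrow> graph G \<and> verts G \<noteq> {} \<and> min_degree G \<ge> p - 1"
  shows "\<exists>V\<^sub>1 V\<^sub>2. V\<^sub>1 \<union> V\<^sub>2 = verts H \<and> V\<^sub>1 \<inter> V\<^sub>2 = {} \<and>
           max_order_free_induced \<G> H V\<^sub>1 \<and>
           max_degree (H \<restriction> V\<^sub>2) \<le> q \<and>
           (graph_free (complete_graph q) (H \<restriction> V\<^sub>2) \<or> cliques_disjoint q (H \<restriction> V\<^sub>2))"
proof -
  interpret H: graph H by fact
  let ?adj = "\<lambda>u v. (u, v) \<in> arcs_ends H"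
  interpret adjacency ?adj
  proof
    show "(y, x) \<in> arcs_ends H" if "(x, y) \<in> arcs_ends H" for x y
      using that H.sym_arcs unfolding symmetric_def sym_def by blast
    show "(x, x) \<notin> arcs_ends H" for x
      using H.no_loops by (auto simp: arcs_ends_conv)
  qed
  have nbrs: "nbrs v W = {w \<in> W. (v, w) \<in> arcs_ends H}" for v W by (simp add: nbrs_def)
  have nbrs_le: "card (nbrs v (verts H)) < p + q" if "v \<in> verts H" for v
  proof -
    have "nbrs v (verts H) = {w. (v, w) \<in> arcs_ends H}"
      unfolding nbrs by (auto simp: arcs_ends_conv)
    then have "card (nbrs v (verts H)) = out_degree H v"
      using out_degree_eq_card_nbrs[OF H.digraph_axioms] by simp
    also have "\<dots> \<le> max_degree H"
      unfolding max_degree_def using that by (intro Max_ge) auto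
    finally show ?thesis using assms(7) by simp
  qed
  have \<G>: "graph G \<and> min_degree G \<ge> p - 1" if "G \<in> \<G>" for G using assms(8)[OF that] by blast
  interpret exchange_family ?adj "verts H" p q "{X. max_order_free_induced \<G> H X}"
  proof
    show "\<not> near_clique W" if "W \<subseteq> verts H" "card W = p + q" for W
    proof
      assume "near_clique W"
      then obtain x y where near: "\<And>a b. a \<in> W \<Longrightarrow> b \<in> W \<Longrightarrow> a \<noteq> b \<Longrightarrow> ?adj a b \<or> {a, b} = {x, y}"
        unfolding near_clique_def by blast
      show False
        by (rule graph_free_no_near_clique[OF assms(1,4) that(1) _ _ near])
          (use that(2) assms(5,7) in auto)
    qed
  next
    fix X v assume X: "X \<in> {X. max_order_free_induced \<G> H X}" and v: "v \<in> verts H - X"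
    have XV: "X \<subseteq> verts H" and free: "family_free \<G> (H \<restriction> X)"
      and max: "\<And>S. S \<subseteq> verts H \<Longrightarrow> family_free \<G> (H \<restriction> S) \<Longrightarrow> card S \<le> card X"
      using X by (auto simp: max_order_free_induced_def)
    have fin: "finite X" using XV H.finite_verts finite_subset by blast
    have "\<not> family_free \<G> (H \<restriction> insert v X)"
      using max[of "insert v X"] XV v fin by auto
    moreover have "insert v X \<subseteq> verts H" using XV v by blast
    ultimately have "p - 1 \<le> card (nbrs v (insert v X))"
      unfolding nbrs using copy_through_vertex[OF assms(1) \<G> free _ subset_refl] by blast
    also have "nbrs v (insert v X) = nbrs v X" using adj_irrefl by (auto simp: nbrs_def)
    finally show "p \<le> card (nbrs v X) + 1" by simp
    fix u assume u: "card (nbrs v X) + 1 = p" "u \<in> nbrs v X"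
    let ?W = "insert v (X - {u})"
    have uX: "u \<in> X" using u by (simp add: nbrs_def)
    \<comment> \<open>A copy in the exchanged set would need \<open>p - 1\<close> neighbours of \<open>v\<close>, but \<open>u\<close> was one of only \<open>p - 1\<close>.\<close>
    have "nbrs v ?W = nbrs v X - {u}" using adj_irrefl by (auto simp: nbrs_def)
    then have less: "card (nbrs v ?W) < p - 1"
      using u fin assms(5) by (simp add: card_Diff_singleton)
    have W: "?W \<subseteq> insert v X" "?W \<subseteq> verts H" using XV v by auto
    have "family_free \<G> (H \<restriction> ?W)"
    proof (rule ccontr)
      assume "\<not> family_free \<G> (H \<restriction> ?W)"
      from copy_through_vertex[OF assms(1) \<G> free this W] have "p - 1 \<le> card (nbrs v ?W)"
        unfolding nbrs .
      then show False using less by linarith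
    qed
    moreover have "card ?W = card X" using fin v card_Suc_Diff1[OF fin uX] by simp
    ultimately show "?W \<in> {X. max_order_free_induced \<G> H X}"
      using X v XV by (auto simp: max_order_free_induced_def)
  next
    show "{X. max_order_free_induced \<G> H X} \<noteq> {}"
      using ex_max_order_free_induced[OF H.finite_verts, of \<G>] assms(8) by blast
  qed (use assms nbrs_le in \<open>auto simp: max_order_free_induced_def\<close>)
  obtain X where X: "max_order_free_induced \<G> H X" and no_bad: "bad X = {}"
    using ex_member_without_bad by blast
  have XV: "X \<subseteq> verts H" using X by (simp add: max_order_free_induced_def)
  let ?G = "H \<restriction> (verts H - X)"
  have G: "digraph ?G" by (rule H.digraphI_induced[OF H.induced_induce]) auto
  have "out_degree ?G v \<le> q" if "v \<in> verts H - X" for v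
  proof -
    have "out_degree ?G v = card {w. (v, w) \<in> arcs_ends ?G}"
      by (rule out_degree_eq_card_nbrs[OF G])
    also have "{w. (v, w) \<in> arcs_ends ?G} = nbrs v (verts H - X)"
      using that by (auto simp: arcs_ends_restrict nbrs)
    also have "card \<dots> \<le> q" using outer_degree_le[of X v] X that by simp
    finally show ?thesis .
  qed
  then have deg: "max_degree ?G \<le> q"
    using H.finite_verts by (auto simp: max_degree_def)
  have "cliques_disjoint q ?G"
  proof (rule cliques_disjoint_if_no_bad_set[OF G deg])
    fix W x y
    assume W: "W \<subseteq> verts ?G" "card W = Suc q"
      and near: "\<And>a b. a \<in> W \<Longrightarrow> b \<in> W \<Longrightarrow> a \<noteq> b \<Longrightarrow> (a, b) \<in> arcs_ends ?G \<or> {a, b} = {x, y}"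
    have "near_clique W"
    proof (rule near_clique_if_missing)
      fix a b assume "a \<in> W" "b \<in> W" "a \<noteq> b"
      from near[OF this] show "?adj a b \<or> {a, b} = {x, y}" by (auto simp: arcs_ends_restrict)
    qed
    then have "W \<in> bad X" using W by (auto simp: bad_def)
    then show False using no_bad by blast
  qed
  moreover have "X \<union> (verts H - X) = verts H" "X \<inter> (verts H - X) = {}" using XV by auto
  ultimately show ?thesis using X deg by blast
qed

end
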